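(* Let $f\colon S\to S^3$ be a non-conformal harmonic map with adapted complex coordinate $z$. Then the $(+)$transform and the $(-)$transform are mutual inverses in the sense that $$(f^+)^-=(f^-)^+=f .$$
   Context: Identify $\mathbb{R}^4$ with the quaternions $\mathbb{H}$ (basis $1,e_1,e_2,e_3$ with $e_1^2=e_2^2=e_3^2=e_1e_2e_3=-1$), $\mathbb{R}^3$ with the imaginary quaternions $\operatorname{Im}\mathbb{H}$, and $S^3$ with the unit quaternions. $\langle\,,\rangle$ and $\times$ denote the Euclidean inner product and the vector product of $\mathbb{R}^3$, extended complex-bilinearly to complexified vectors. For a complex coordinate $z=x+iy$ write $\partial=\partial/\partial z$, $\bar\partial=\partial/\partial\bar z$. A smooth map $f\colon S\to S^3\subset\mathbb{R}^4$ from a Riemann surface is harmonic if $\partial\bar\partial f=-|\partial f|^2 f$, where $|\partial f|^2=\langle\partial f,\bar\partial f\rangle$. Then $\langle\partial f,\partial f\rangle$ is holomorphic. The map is called non-conformal if $\langle \partial f,\partial f\rangle\neq 0$; then there are complex coordinates $z$ with $\langle\partial f,\partial f\rangle=-1$, called adapted complex coordinates for $f$. Standing convention: an adapted coordinate $z=x+iy$ is fixed on $S$ (i.e. $S$ is the domain of the adapted coordinate), and it is used for all constructions. Define $\operatorname{Im}\mathbb{H}$-valued functions $\alpha,\beta$ by $f_x=f\alpha$, $f_y=f\beta$ (quaternion product). Adaptedness gives $\langle\alpha,\beta\rangle=0$ and a non-negative function $\phi$ with $|\alpha|=2\sinh\phi$, $|\beta|=2\cosh\phi$. Where $\alpha\ne0$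 (equivalently $\phi>0$) put $N=\tfrac{1}{2}\operatorname{csch}(2\phi)\, f(\alpha\times\beta)$, the unit normal. The transforms are $$f^{\pm}=\pm\tfrac{i}{2}\operatorname{sech}^2\phi\,(\partial f-\bar\partial f)+\tanh\phi\,N=\tfrac12\operatorname{sech}^2\phi\; f\bigl(\pm\beta+\tfrac12\,\alpha\times\beta\bigr).$$ Standing assumption: one works on the set where $\alpha\neq0$, i.e. $\phi>0$ on $S$ (the last expression for $f^\pm$ makes sense also where $\alpha=0$, and can be used for the second transform at points where the corresponding function for $f^\pm$ vanishes). It is known that $f^\pm$ are again non-conformal harmonic maps $S\to S^3$ for which the same $z$ is an adapted coordinate; $(f^+)^-$ and $(f^-)^+$ are formed with this same coordinate $z$. *)

theory Defs
  imports "HOL-Analysis.Analysis"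
begin

section \<open>Quaternions\<close>

text \<open>
  A vector of \<^typ>\<open>real^4\<close> with components \<open>q$1, q$2, q$3, q$4\<close> stands for the quaternion
  \<open>q$1 + q$2 e1 + q$3 e2 + q$4 e3\<close>; a vector of \<^typ>\<open>real^3\<close> stands for an imaginary quaternion.
\<close>

definition qmult :: "real^4 \<Rightarrow> real^4 \<Rightarrow> real^4"  (infixl \<open>\<odot>\<close> 70) where
  "p \<odot> q = vector
     [p$1 * q$1 - p$2 * q$2 - p$3 * q$3 - p$4 * q$4,
      p$1 * q$2 + p$2 * q$1 + p$3 * q$4 - p$4 * q$3,
      p$1 * q$3 - p$2 * q$4 + p$3 * q$1 + p$4 * q$2,
      p$1 * q$4 + p$2 * q$3 - p$3 * q$2 + p$4 * q$1]"

definition imq :: "real^3 \<Rightarrow> real^4" where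
  "imq v = vector [0, v$1, v$2, v$3]"

lemma vector4_nth [simp]:
  "(vector [a, b, c, d] :: 'a::zero^4) $ 1 = a"
  "(vector [a, b, c, d] :: 'a::zero^4) $ 2 = b"
  "(vector [a, b, c, d] :: 'a::zero^4) $ 3 = c"
  "(vector [a, b, c, d] :: 'a::zero^4) $ 4 = d"
  by (simp_all add: vector_def)

lemma qmult_units:
  fixes e1 e2 e3 :: "real^4"
  defines "e1 \<equiv> axis 2 1" and "e2 \<equiv> axis 3 1" and "e3 \<equiv> axis 4 1"
  shows "e1 \<odot> e1 = - axis 1 1" "e2 \<odot> e2 = - axis 1 1" "e3 \<odot> e3 = - axis 1 1"
    and "e1 \<odot> e2 \<odot> e3 = - axis 1 1" "axis 1 1 \<odot> q = q" "q \<odot> axis 1 1 = q"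
  by (simp_all add: assms qmult_def vec_eq_iff forall_4 axis_def)

lemma qmult_assoc: "p \<odot> q \<odot> r = p \<odot> (q \<odot> r)"
  by (simp add: qmult_def vec_eq_iff forall_4 algebra_simps)

lemma bilinear_qmult: "bilinear (\<odot>)"
  by (simp add: bilinear_def qmult_def linear_iff vec_eq_iff forall_4 algebra_simps)


section \<open>Smoothness and complex derivatives\<close>

text \<open>Being of class \<open>C^k\<close>; meant for open \<open>U\<close>.\<close>

fun C_k_on :: "nat \<Rightarrow> complex set \<Rightarrow> (complex \<Rightarrow> 'b::real_normed_vector) \<Rightarrow> bool" where
  "C_k_on 0 U g \<longleftrightarrow> continuous_on U g"
| "C_k_on (Suc k) U g \<longleftrightarrow>
     (\<forall>z\<in>U. g differentiable (at z)) \<and>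
     (\<forall>v. C_k_on k U (\<lambda>z. frechet_derivative g (at z) v))"

definition smooth_on :: "complex set \<Rightarrow> (complex \<Rightarrow> 'b::real_normed_vector) \<Rightarrow> bool" where
  "smooth_on U g \<longleftrightarrow> (\<forall>k. C_k_on k U g)"

text \<open>Partial derivatives with respect to \<open>x\<close> and \<open>y\<close>, where \<open>z = x + iy\<close>.\<close>

definition d_x :: "(complex \<Rightarrow> 'b::real_normed_vector) \<Rightarrow> complex \<Rightarrow> 'b" where
  "d_x g z = frechet_derivative g (at z) 1"

definition d_y :: "(complex \<Rightarrow> 'b::real_normed_vector) \<Rightarrow> complex \<Rightarrow> 'b" where
  "d_y g z = frechet_derivative g (at z) \<i>"

definition del :: "(complex \<Rightarrow> complex^'n) \<Rightarrow> complex \<Rightarrow> complex^'n" where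
  "del g z = (1/2) *s (d_x g z - \<i> *s d_y g z)"

definition delbar :: "(complex \<Rightarrow> complex^'n) \<Rightarrow> complex \<Rightarrow> complex^'n" where
  "delbar g z = (1/2) *s (d_x g z + \<i> *s d_y g z)"

definition cvec :: "real^'n \<Rightarrow> complex^'n" where
  "cvec v = (\<chi> i. complex_of_real (v $ i))"

text \<open>The complex bilinear (not Hermitian) extension of the Euclidean inner product.\<close>

definition cinner :: "complex^'n \<Rightarrow> complex^'n \<Rightarrow> complex" where
  "cinner u v = (\<Sum>i\<in>UNIV. u $ i * v $ i)"


section \<open>Harmonic maps into the 3-sphere\<close>

definition harmonic_on :: "complex set \<Rightarrow> (complex \<Rightarrow> real^4) \<Rightarrow> bool" where
  "harmonic_on U f \<longleftrightarrow> smooth_on U f \<and> f ` U \<subseteq> sphere 0 1 \<and>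
     (\<forall>z\<in>U. del (delbar (cvec \<circ> f)) z =
        - cinner (del (cvec \<circ> f) z) (delbar (cvec \<circ> f) z) *s cvec (f z))"

definition nonconformal_on :: "complex set \<Rightarrow> (complex \<Rightarrow> real^4) \<Rightarrow> bool" where
  "nonconformal_on U f \<longleftrightarrow> (\<forall>z\<in>U. cinner (del (cvec \<circ> f) z) (del (cvec \<circ> f) z) \<noteq> 0)"

text \<open>The standard coordinate of \<open>U\<close> is adapted for \<open>f\<close>.\<close>

definition adapted_on :: "complex set \<Rightarrow> (complex \<Rightarrow> real^4) \<Rightarrow> bool" where
  "adapted_on U f \<longleftrightarrow> (\<forall>z\<in>U. cinner (del (cvec \<circ> f) z) (del (cvec \<circ> f) z) = -1)"


section \<open>The transforms\<close>

text \<open>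
  The objects below are characterised uniquely when \<open>f\<close> takes values in the unit sphere and the
  coordinate is adapted (see \<open>d_x_eq_alpha\<close>, \<open>d_y_eq_beta\<close>, \<open>phi_props\<close>).
\<close>

definition alpha :: "(complex \<Rightarrow> real^4) \<Rightarrow> complex \<Rightarrow> real^3" where
  "alpha f z = (THE a. d_x f z = f z \<odot> imq a)"

definition beta :: "(complex \<Rightarrow> real^4) \<Rightarrow> complex \<Rightarrow> real^3" where
  "beta f z = (THE b. d_y f z = f z \<odot> imq b)"

definition phi :: "(complex \<Rightarrow> real^4) \<Rightarrow> complex \<Rightarrow> real" where
  "phi f z = (THE t. 0 \<le> t \<and> norm (alpha f z) = 2 * sinh t \<and> norm (beta f z) = 2 * cosh t)"

definition unit_normal :: "(complex \<Rightarrow> real^4) \<Rightarrow> complex \<Rightarrow> real^4" where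
  "unit_normal f z =
     (1 / (2 * sinh (2 * phi f z))) *\<^sub>R (f z \<odot> imq (cross3 (alpha f z) (beta f z)))"

text \<open>
  The transform with sign \<open>s = 1\<close> or \<open>s = -1\<close>, in the form that makes sense also where
  \<open>alpha\<close> vanishes; \<open>cvec_transform_eq\<close> gives the expression in terms of the unit normal.
\<close>

definition transform :: "real \<Rightarrow> (complex \<Rightarrow> real^4) \<Rightarrow> complex \<Rightarrow> real^4" where
  "transform s f z = (1 / (2 * (cosh (phi f z))\<^sup>2)) *\<^sub>R
     (f z \<odot> imq (s *\<^sub>R beta f z + (1/2) *\<^sub>R cross3 (alpha f z) (beta f z)))"

definition plus_transform :: "(complex \<Rightarrow> real^4) \<Rightarrow> complex \<Rightarrow> real^4" where
  "plus_transform = transform 1"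

definition minus_transform :: "(complex \<Rightarrow> real^4) \<Rightarrow> complex \<Rightarrow> real^4" where
  "minus_transform = transform (-1)"


subsection \<open>The defining descriptions are met\<close>

lemma qmult_imq_unique:
  assumes q: "norm q = 1" and v: "q \<bullet> v = 0"
  shows "\<exists>!a. v = q \<odot> imq a"
proof -
  have q2: "q$1 * q$1 + q$2 * q$2 + q$3 * q$3 + q$4 * q$4 = 1"
    using q by (simp add: norm_eq_1 inner_vec_def sum_4)
  have v0: "q$1 * v$1 + q$2 * v$2 + q$3 * v$3 + q$4 * v$4 = 0"
    using v by (simp add: inner_vec_def sum_4)
  define q' :: "real^4" where "q' = vector [q$1, - q$2, - q$3, - q$4]"
  have one: "q' \<odot> q = axis 1 1" "q \<odot> q' = axis 1 1"
    using q2 by (simp_all add: q'_def qmult_def vec_eq_iff forall_4 axis_def algebra_simps)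
  define w where "w = q' \<odot> v"
  have w1: "w $ 1 = 0"
    using v0 by (simp add: w_def q'_def qmult_def)
  have w: "imq (vector [w$2, w$3, w$4]) = w"
    using w1 by (simp add: imq_def vec_eq_iff forall_4)
  have "v = q \<odot> w"
    unfolding w_def by (simp add: qmult_assoc[symmetric] one qmult_units)
  moreover have "a = b" if "q \<odot> imq a = q \<odot> imq b" for a b
  proof -
    have "imq a = imq b"
      using that by (metis one(1) qmult_assoc qmult_units(5))
    then show ?thesis
      by (simp add: imq_def vec_eq_iff forall_4 forall_3)
  qed
  ultimately show ?thesis
    using w by metis
qed

lemma norm_qmult_imq:
  assumes "norm q = 1"
  shows "norm (q \<odot> imq a) = norm a"
proof -
  have q2: "q$1 * q$1 + q$2 * q$2 + q$3 * q$3 + q$4 * q$4 = 1"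
    using assms by (simp add: norm_eq_1 inner_vec_def sum_4)
  have "(q \<odot> imq a) \<bullet> (q \<odot> imq a)
      = (q$1 * q$1 + q$2 * q$2 + q$3 * q$3 + q$4 * q$4) * (a \<bullet> a)"
    by (simp add: qmult_def imq_def inner_vec_def sum_4 sum_3 algebra_simps)
  then show ?thesis
    by (simp add: q2 norm_eq_sqrt_inner)
qed

context
  fixes U f z
  assumes U: "open U" and z: "z \<in> U" and harm: "harmonic_on U f"
begin

lemma diff_at: "f differentiable (at z)"
  using harm z unfolding harmonic_on_def smooth_on_def
  by (metis C_k_on.simps(2))

lemma norm_at: "norm (f z) = 1"
  using harm z by (auto simp: harmonic_on_def)

lemma deriv_orthogonal: "f z \<bullet> frechet_derivative f (at z) v = 0"
proof -
  have D: "(f has_derivative frechet_derivative f (at z)) (at z)"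
    using diff_at frechet_derivative_works by blast
  have "((\<lambda>w. f w \<bullet> f w) has_derivative
      (\<lambda>h. f z \<bullet> frechet_derivative f (at z) h + frechet_derivative f (at z) h \<bullet> f z)) (at z)"
    by (rule has_derivative_inner[OF D D])
  moreover have "((\<lambda>w. f w \<bullet> f w) has_derivative (\<lambda>h. 0)) (at z)"
  proof (rule has_derivative_transform_within_open[OF _ U z])
    show "((\<lambda>w. 1::real) has_derivative (\<lambda>h. 0)) (at z)" by simp
    show "1 = f w \<bullet> f w" if "w \<in> U" for w
      using harm that by (auto simp: harmonic_on_def norm_eq_1)
  qed
  ultimately have "(\<lambda>h. f z \<bullet> frechet_derivative f (at z) h + frechet_derivative f (at z) h \<bullet> f z)
      = (\<lambda>h. 0)"
    by (rule has_derivative_unique)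
  from fun_cong[OF this, of v] show ?thesis
    by (simp add: inner_commute)
qed

lemma d_x_eq_alpha: "d_x f z = f z \<odot> imq (alpha f z)"
  unfolding alpha_def d_x_def
  by (rule theI') (rule qmult_imq_unique[OF norm_at deriv_orthogonal])

lemma d_y_eq_beta: "d_y f z = f z \<odot> imq (beta f z)"
  unfolding beta_def d_y_def
  by (rule theI') (rule qmult_imq_unique[OF norm_at deriv_orthogonal])

lemma deriv_cvec: "frechet_derivative (cvec \<circ> f) (at z) v = cvec (frechet_derivative f (at z) v)"
proof -
  have D: "(f has_derivative frechet_derivative f (at z)) (at z)"
    using diff_at frechet_derivative_works by blast
  have "linear (cvec :: real^4 \<Rightarrow> complex^4)"
    by (rule linearI) (simp_all add: cvec_def vec_eq_iff scaleR_conv_of_real[where 'a = complex])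
  then have "bounded_linear (cvec :: real^4 \<Rightarrow> complex^4)"
    by (rule linear_conv_bounded_linear[THEN iffD1])
  from bounded_linear.has_derivative[OF this D]
  have "(cvec \<circ> f has_derivative (\<lambda>h. cvec (frechet_derivative f (at z) h))) (at z)"
    by (simp add: o_def)
  then show ?thesis
    by (metis frechet_derivative_at)
qed

lemma phi_props:
  assumes "adapted_on U f"
  shows "0 \<le> phi f z" "norm (alpha f z) = 2 * sinh (phi f z)" "norm (beta f z) = 2 * cosh (phi f z)"
proof -
  define a where "a = d_x f z"
  define b where "b = d_y f z"
  have "cinner (del (cvec \<circ> f) z) (del (cvec \<circ> f) z)
      = (1/4) * complex_of_real (a \<bullet> a - b \<bullet> b) - (\<i>/2) * complex_of_real (a \<bullet> b)"
    by (simp add: del_def d_x_def d_y_def deriv_cvec a_def b_def cinner_def cvec_def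
        inner_vec_def sum_4 field_simps)
  with assms z have "(1/4) * complex_of_real (a \<bullet> a - b \<bullet> b) - (\<i>/2) * complex_of_real (a \<bullet> b) = -1"
    by (simp add: adapted_on_def)
  then have "b \<bullet> b = a \<bullet> a + 4"
    by (simp add: complex_eq_iff)
  then have n: "(norm (beta f z))\<^sup>2 = (norm (alpha f z))\<^sup>2 + 4"
    by (simp add: a_def b_def d_x_eq_alpha d_y_eq_beta norm_at flip: power2_norm_eq_inner
        add: norm_qmult_imq)
  let ?P = "\<lambda>t. 0 \<le> t \<and> norm (alpha f z) = 2 * sinh t \<and> norm (beta f z) = 2 * cosh t"
  define t where "t = arsinh (norm (alpha f z) / 2)"
  have s: "norm (alpha f z) = 2 * sinh t"
    by (simp add: t_def)
  have "(norm (beta f z))\<^sup>2 = (2 * cosh t)\<^sup>2"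
    using n unfolding s by (simp add: cosh_square_eq algebra_simps)
  then have c: "norm (beta f z) = 2 * cosh t"
    by (rule power2_eq_imp_eq) simp_all
  have "0 \<le> sinh t"
    using s by (metis norm_ge_zero zero_le_mult_iff zero_le_numeral not_numeral_le_zero)
  then have "0 \<le> t" by simp
  with s c have "?P t" by simp
  moreover have "u = t" if "?P u" for u
    using that s by simp
  ultimately have "?P (phi f z)"
    unfolding phi_def by (rule theI)
  then show "0 \<le> phi f z" "norm (alpha f z) = 2 * sinh (phi f z)"
      "norm (beta f z) = 2 * cosh (phi f z)"
    by auto
qed

lemma cvec_transform_eq:
  assumes "adapted_on U f" and "alpha f z \<noteq> 0"
  shows "cvec (transform s f z) =
      (complex_of_real s * (\<i>/2) / complex_of_real ((cosh (phi f z))\<^sup>2)) *s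
          (del (cvec \<circ> f) z - delbar (cvec \<circ> f) z)
      + complex_of_real (tanh (phi f z)) *s cvec (unit_normal f z)"
proof -
  define t where "t = phi f z"
  define c where "c = cross3 (alpha f z) (beta f z)"
  have "sinh t \<noteq> 0"
    using phi_props(2)[OF assms(1)] assms(2) by (auto simp: t_def)
  then have k: "tanh t * (1 / (2 * sinh (2 * t))) = 1 / (4 * (cosh t)\<^sup>2)"
    unfolding sinh_double tanh_def by (simp add: power2_eq_square)
  have "transform s f z = (s / (2 * (cosh t)\<^sup>2)) *\<^sub>R (f z \<odot> imq (beta f z))
      + (1 / (4 * (cosh t)\<^sup>2)) *\<^sub>R (f z \<odot> imq c)"
    unfolding transform_def t_def c_def
    by (simp add: qmult_def imq_def vec_eq_iff forall_4 field_simps)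
  also have "\<dots> = (s / (2 * (cosh t)\<^sup>2)) *\<^sub>R d_y f z + tanh t *\<^sub>R unit_normal f z"
    by (simp add: unit_normal_def d_y_eq_beta k[symmetric] flip: t_def c_def)
  finally have 1: "transform s f z = \<dots>" .
  have 2: "del (cvec \<circ> f) z - delbar (cvec \<circ> f) z = - \<i> *s cvec (d_y f z)"
    by (simp add: del_def delbar_def d_x_def d_y_def deriv_cvec vec_eq_iff field_simps)
  show ?thesis
    unfolding 1 2 t_def[symmetric]
    by (simp add: cvec_def vec_eq_iff field_simps)
qed

end

end

theory Submission
  imports Defs
begin

text \<open>
  Write \<open>a, b\<close> for \<open>alpha f, beta f\<close>, and let \<open>g = transform s f = f u\<close> with \<open>s = 1\<close> or \<open>s = -1\<close>.
  Then \<open>u\<close> is an imaginary unit and \<open>a = - 2 s - u b\<close>, an equation which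
  conversely determines \<open>g\<close>. Differentiating it and inserting the structure
  equations \<open>a_x + b_y = 0\<close> and \<open>a_y - b_x = a b - b a\<close> of a harmonic map, one can cancel \<open>b\<close>
  and obtains \<open>a u + u_x = 2 s u + u (b u + u_y)\<close>. For the logarithmic derivatives \<open>a', b'\<close>
  of \<open>g\<close> this says \<open>a' = 2 s + u b'\<close>, the same kind of equation with \<open>s\<close> replaced by
  \<open>- s\<close> and \<open>u\<close> by \<open>- u\<close>; it characterises \<open>g (- u) = f\<close> as the transform of \<open>g\<close> with sign \<open>- s\<close>.
\<close>

section \<open>Quaternion algebra\<close>

interpretation qmult: bounded_bilinear "(\<odot>)"
  using bilinear_qmult by (simp add: bilinear_conv_bounded_bilinear)

lemmas qmult_algebra =
  qmult.add_left qmult.add_right qmult.diff_left qmult.diff_right qmult.minus_left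
  qmult.minus_right qmult.scaleR_left qmult.scaleR_right qmult_assoc qmult_units(5,6)

lemma linear_imq: "linear imq"
  by (simp add: linear_iff imq_def vec_eq_iff forall_4)

lemmas imq_linear =
  linear_add[OF linear_imq] linear_diff[OF linear_imq] linear_neg[OF linear_imq]
  linear_scale[OF linear_imq] linear_0[OF linear_imq]

text \<open>Inverts unit quaternions and is linear, hence easy to differentiate.\<close>

definition qconj :: "real^4 \<Rightarrow> real^4" where
  "qconj q = vector [q$1, - q$2, - q$3, - q$4]"

lemma linear_qconj: "linear qconj"
  by (simp add: linear_iff qconj_def vec_eq_iff forall_4)

lemma bounded_linear_qconj: "bounded_linear qconj"
  using linear_qconj by (simp add: linear_conv_bounded_linear)

lemma qconj_qmult: "qconj (p \<odot> q) = qconj q \<odot> qconj p"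
  by (simp add: qconj_def qmult_def vec_eq_iff forall_4 algebra_simps)

lemma qconj_imq: "qconj (imq a) = - imq a"
  by (simp add: qconj_def imq_def vec_eq_iff forall_4)

lemma qconj_mult_self: "qconj q \<odot> q = (q \<bullet> q) *\<^sub>R axis 1 1"
  by (simp add: qconj_def qmult_def inner_vec_def sum_4 vec_eq_iff forall_4 axis_def algebra_simps)

lemma mult_qconj_self: "q \<odot> qconj q = (q \<bullet> q) *\<^sub>R axis 1 1"
  by (simp add: qconj_def qmult_def inner_vec_def sum_4 vec_eq_iff forall_4 axis_def algebra_simps)

lemma qconj_cancel: "norm q = 1 \<Longrightarrow> qconj q \<odot> (q \<odot> p) = p"
  by (simp add: norm_eq_1 qconj_mult_self qmult_units flip: qmult_assoc)

text \<open>The dictionary between quaternion identities and the vector formula of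
  \<open>transform\<close>.\<close>

lemma imq_mult_imq: "imq a \<odot> imq b = imq (cross3 a b) - (a \<bullet> b) *\<^sub>R axis 1 1"
  by (simp add: imq_def qmult_def cross3_def inner_vec_def sum_3 vec_eq_iff forall_4 axis_def)

lemma imq_inject: "imq a = imq b \<longleftrightarrow> a = b"
  by (simp add: imq_def vec_eq_iff forall_4 forall_3)

lemma imq_plus_real_eq_iff:
  "imq a + x *\<^sub>R axis 1 1 = imq b + y *\<^sub>R axis 1 1 \<longleftrightarrow> a = b \<and> x = y"
  by (auto simp: imq_def vec_eq_iff forall_4 forall_3 axis_def)

section \<open>The transform at a single point\<close>

text \<open>Needs only data at \<open>z\<close>, so it applies to the transform of \<open>f\<close>
  without knowing that map to be harmonic. Since \<open>b \<bullet> b = 4 (cosh phi)^2\<close>, the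
  coefficient becomes rational in \<open>b\<close> and \<open>phi\<close> disappears.\<close>

lemma transform_eqI:
  assumes n: "norm (f z) = 1"
    and x: "d_x f z = f z \<odot> imq a" and y: "d_y f z = f z \<odot> imq b"
    and ab: "b \<bullet> b = a \<bullet> a + 4"
  shows "alpha f z = a" "beta f z = b"
    and "transform s f z =
      f z \<odot> imq ((2 / (b \<bullet> b)) *\<^sub>R (s *\<^sub>R b + (1/2) *\<^sub>R cross3 a b))"
proof -
  have inj: "c = d" if "f z \<odot> imq c = f z \<odot> imq d" for c d
    using arg_cong[OF that, of "\<lambda>q. qconj (f z) \<odot> q"]
    unfolding qconj_cancel[OF n] imq_inject .
  show 1: "alpha f z = a"
    unfolding alpha_def by (rule the_equality) (use x inj in auto)
  show 2: "beta f z = b"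
    unfolding beta_def by (rule the_equality) (use y inj in auto)
  define t where "t = arsinh (norm a / 2)"
  have s: "norm a = 2 * sinh t" by (simp add: t_def)
  have c2: "b \<bullet> b = 4 * (cosh t)\<^sup>2"
    using ab by (simp add: cosh_square_eq s power_mult_distrib flip: power2_norm_eq_inner)
  then have "(norm b)\<^sup>2 = (2 * cosh t)\<^sup>2"
    by (simp add: power2_norm_eq_inner power_mult_distrib)
  then have c: "norm b = 2 * cosh t"
    by (rule power2_eq_imp_eq) simp_all
  have "phi f z = t"
    unfolding phi_def 1 2
  proof (rule the_equality)
    have "0 \<le> sinh t" using s norm_ge_zero[of a] by linarith
    then show "0 \<le> t \<and> norm a = 2 * sinh t \<and> norm b = 2 * cosh t"
      by (simp add: s c)
  qed (simp add: s)
  then show "transform s f z =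
      f z \<odot> imq ((2 / (b \<bullet> b)) *\<^sub>R (s *\<^sub>R b + (1/2) *\<^sub>R cross3 a b))"
    unfolding transform_def 1 2 c2
    by (simp add: imq_linear qmult.scaleR_right)
qed

text \<open>The vectors \<open>a\<close>, \<open>b\<close> and \<open>cross3 a b\<close> are
  mutually orthogonal. By \<open>imq_mult_imq\<close> the last two claims together say
  \<open>a = - 2 s - u b\<close>.\<close>

lemma transform_vector:
  fixes a b :: "real^3"
  assumes ab: "a \<bullet> b = 0" "b \<bullet> b = a \<bullet> a + 4" and s: "s\<^sup>2 = 1"
  defines "u \<equiv> (2 / (b \<bullet> b)) *\<^sub>R (s *\<^sub>R b + (1/2) *\<^sub>R cross3 a b)"
  shows "norm u = 1" "u \<bullet> b = 2 * s" "cross3 u b = - a"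
proof -
  have b: "b \<bullet> b > 0" using ab(2) by (smt (verit) inner_ge_zero)
  have ss: "s * s = 1" using s by (simp add: power2_eq_square)
  have ort: "b \<bullet> cross3 a b = 0" "cross3 a b \<bullet> b = 0" by (simp_all add: dot_cross_self)
  show "u \<bullet> b = 2 * s"
    using b by (simp add: u_def inner_add_left ort)
  have "cross3 a b \<bullet> cross3 a b = (a \<bullet> a) * (b \<bullet> b)"
    using ab(1) by (simp add: dot_cross)
  then have "u \<bullet> u = (2 / (b \<bullet> b))\<^sup>2 * (b \<bullet> b + (1/4) * ((a \<bullet> a) * (b \<bullet> b)))"
    by (simp add: u_def inner_add_left inner_add_right ort power2_eq_square algebra_simps ss)
  \<comment> \<open>The left side is \<open>(b \<bullet> b) (4 + a \<bullet> a) / 4\<close>, a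
    square by adaptedness.\<close>
  also have "b \<bullet> b + (1/4) * ((a \<bullet> a) * (b \<bullet> b)) = ((b \<bullet> b) / 2)\<^sup>2"
    using ab(2) by (simp add: power2_eq_square field_simps)
  finally show "norm u = 1"
    using b by (simp add: norm_eq_1 power_mult_distrib[symmetric])
  have "cross3 (cross3 a b) b = - (b \<bullet> b) *\<^sub>R a"
    using ab(1) by (simp add: cross_skew[of "cross3 a b"] Lagrange inner_commute)
  then show "cross3 u b = - a"
    using b by (simp add: u_def cross_mult_left cross_add_left cross_refl)
qed

text \<open>The converse: the imaginary and real parts of \<open>rel\<close> give
  \<open>cross3 u b\<close> and \<open>u \<bullet> b\<close>, which recover the length relation and
  force the vector of the transform with sign \<open>- s\<close> to be \<open>- u\<close>.\<close>

lemma transform_inverse_at: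
  assumes n: "norm (g z) = 1"
    and x: "d_x g z = g z \<odot> imq a" and y: "d_y g z = g z \<odot> imq b"
    and u: "norm u = 1" and s: "s\<^sup>2 = 1" and g: "g z = p \<odot> imq u"
    and rel: "imq a = (2 * s) *\<^sub>R axis 1 1 + imq u \<odot> imq b"
  shows "transform (- s) g z = p"
proof -
  from rel have "imq a + 0 *\<^sub>R axis 1 1 = imq (cross3 u b) + (2 * s - u \<bullet> b) *\<^sub>R axis 1 1"
    by (simp add: imq_mult_imq algebra_simps)
  then have a: "a = cross3 u b" and ub: "u \<bullet> b = 2 * s"
    by (auto simp only: imq_plus_real_eq_iff)
  have uu: "u \<bullet> u = 1" using u by (simp add: norm_eq_1)
  have "a \<bullet> a = b \<bullet> b - (2 * s) * (2 * s)"
    unfolding a dot_cross using uu ub by (simp add: inner_commute)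
  then have ab: "b \<bullet> b = a \<bullet> a + 4"
    using s by (simp add: power2_eq_square)
  have b: "b \<bullet> b \<noteq> 0" using ab by (smt (verit) inner_ge_zero)
  have "cross3 a b = (2 * s) *\<^sub>R b - (b \<bullet> b) *\<^sub>R u"
    unfolding a using ub by (simp add: cross_skew[of "cross3 u b"] Lagrange inner_commute)
  \<comment> \<open>Half of \<open>2 s b\<close> cancels \<open>- s b\<close>; this is where the
    opposite sign enters.\<close>
  then have "(2 / (b \<bullet> b)) *\<^sub>R (- s *\<^sub>R b + (1/2) *\<^sub>R cross3 a b) = - u"
    using b by (simp add: vec_eq_iff field_simps)
  then have "transform (- s) g z = - (g z \<odot> imq u)"
    by (simp add: transform_eqI(3)[OF n x y ab]
        imq_linear qmult.minus_right)
  also have "\<dots> = p"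
    using uu by (simp add: g qmult_assoc imq_mult_imq qmult_algebra
        imq_linear)
  finally show ?thesis .
qed

section \<open>The algebraic core\<close>

text \<open>Names such as \<open>a_x\<close> stand for values of derivatives at a point. Multiplying
  the flatness equation by \<open>u\<close> frees \<open>b_y\<close>, because \<open>u\<close>
  squares to \<open>-1\<close>; the harmonic equation then eliminates it.\<close>

lemma baecklund_algebra:
  assumes flat: "a_y - b_x = a \<odot> b - b \<odot> a" and harm: "a_x + b_y = 0"
    and ub: "u \<odot> b + b \<odot> u = - (4 * s) *\<^sub>R axis 1 1" and uu: "u \<odot> u = - axis 1 1"
    and b: "b \<odot> c = axis 1 1"
    and a: "a = - (2 * s) *\<^sub>R axis 1 1 - u \<odot> b"
    and ax: "a_x = - (u_x \<odot> b) - u \<odot> b_x" and ay: "a_y = - (u_y \<odot> b) - u \<odot> b_y"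
  shows "a \<odot> u + u_x = (2 * s) *\<^sub>R u + u \<odot> (b \<odot> u + u_y)"
proof -
  have uux: "u \<odot> (u \<odot> w) = - w" for w
    by (simp add: uu qmult_algebra flip: qmult_assoc)
  have bu: "b \<odot> u = - (4 * s) *\<^sub>R axis 1 1 - u \<odot> b"
    using ub by (simp add: algebra_simps)
  have "b_x = - (u_y \<odot> b) - u \<odot> b_y + u \<odot> b \<odot> b - b \<odot> u \<odot> b"
    using flat by (simp add: a ay qmult_algebra algebra_simps)
  then have "u \<odot> b_x = - (u \<odot> u_y \<odot> b) + b_y - b \<odot> b - u \<odot> b \<odot> u \<odot> b"
    by (simp add: qmult_algebra uux)
  moreover have "b_y = u_x \<odot> b + u \<odot> b_x"
    using harm by (simp add: ax algebra_simps)
  \<comment> \<open>The terms \<open>u b_x\<close> cancel, and all others end in the invertible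
    factor \<open>b\<close>.\<close>
  ultimately have "(u_x - u \<odot> u_y - b - u \<odot> b \<odot> u) \<odot> b = 0"
    unfolding qmult_algebra by (simp add: algebra_simps)
  then have "(u_x - u \<odot> u_y - b - u \<odot> b \<odot> u) \<odot> (b \<odot> c) = 0"
    by (metis qmult_assoc qmult.zero_left)
  then have "u_x = u \<odot> u_y + b + u \<odot> b \<odot> u"
    by (simp add: b qmult_units algebra_simps)
  moreover have "u \<odot> b \<odot> u = b - (4 * s) *\<^sub>R u"
    by (simp add: qmult_algebra bu uux)
  ultimately show ?thesis
    unfolding a qmult.add_right qmult.diff_left qmult.add_left qmult_assoc[symmetric]
    by (simp add: qmult_units qmult.scaleR_left qmult.minus_left vec_eq_iff)
qed

section \<open>Adaptedness and the harmonic map equation in real terms\<close>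

lemma inner_qmult_imq: "(q \<odot> imq a) \<bullet> (q \<odot> imq b) = (q \<bullet> q) * (a \<bullet> b)"
  by (simp add: qmult_def imq_def inner_vec_def sum_4 sum_3 algebra_simps)

text \<open>Orthogonality is the imaginary part of adaptedness; the lengths come from
  \<open>phi_props\<close> and \<open>cosh^2 - sinh^2 = 1\<close>.\<close>

lemma adapted_alpha_beta:
  assumes U: "open U" "z \<in> U" and f: "harmonic_on U f" and ad: "adapted_on U f"
  shows "alpha f z \<bullet> beta f z = 0" "beta f z \<bullet> beta f z = alpha f z \<bullet> alpha f z + 4"
proof -
  have "Im (cinner (del (cvec \<circ> f) z) (del (cvec \<circ> f) z)) = - (d_x f z \<bullet> d_y f z) / 2"
    by (simp add: del_def d_x_def d_y_def deriv_cvec[OF U f] cinner_def cvec_def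
        inner_vec_def sum_4 field_simps)
  then have "d_x f z \<bullet> d_y f z = 0"
    using ad U(2) by (simp add: adapted_on_def)
  then show "alpha f z \<bullet> beta f z = 0"
    using norm_at[OF U f]
    by (auto simp: d_x_eq_alpha[OF U f] d_y_eq_beta[OF U f] inner_qmult_imq)
  show "beta f z \<bullet> beta f z = alpha f z \<bullet> alpha f z + 4"
    by (simp add: phi_props[OF U f ad] power_mult_distrib cosh_square_eq flip: power2_norm_eq_inner)
qed

lemma smooth_on_differentiable:
  assumes "smooth_on U f" "z \<in> U"
  shows "f differentiable (at z)" "d_x f differentiable (at z)" "d_y f differentiable (at z)"
proof -
  have "C_k_on (Suc (Suc 0)) U f"
    using assms(1) unfolding smooth_on_def by blast
  then show "f differentiable (at z)" "d_x f differentiable (at z)" "d_y f differentiable (at z)"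
    using assms(2) by (auto simp: d_x_def[abs_def] d_y_def[abs_def])
qed

lemma has_derivative_d_x_d_y:
  assumes "(g has_derivative g') (at z)"
  shows "d_x g z = g' 1" "d_y g z = g' \<i>"
  using frechet_derivative_at[OF assms] by (simp_all add: d_x_def d_y_def)

lemma differentiable_has_derivative_frechet:
  "g differentiable (at z) \<Longrightarrow> (g has_derivative frechet_derivative g (at z)) (at z)"
  by (simp add: frechet_derivative_works)

text \<open>The right-hand side of the harmonic map equation is real, so its imaginary part already
  yields the symmetry of the mixed second derivatives.\<close>

lemma harmonic_second_derivatives:
  assumes U: "open U" "z \<in> U" and f: "harmonic_on U f"
  shows "d_x (d_x f) z + d_y (d_y f) z
      = - (d_x f z \<bullet> d_x f z + d_y f z \<bullet> d_y f z) *\<^sub>R f z"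
    and "d_y (d_x f) z = d_x (d_y f) z"
proof -
  have sm: "smooth_on U f" using f by (simp add: harmonic_on_def)
  note D = smooth_on_differentiable[OF sm U(2), THEN differentiable_has_derivative_frechet]
  define X where "X = frechet_derivative (d_x f) (at z)"
  define Y where "Y = frechet_derivative (d_y f) (at z)"
  \<comment> \<open>Real-linear maps with \<open>delbar (cvec \<circ> f) = L f_x + M f_y\<close> on
    \<open>U\<close>, which reduce its derivative to those of \<open>d_x f\<close> and
    \<open>d_y f\<close>.\<close>
  define L :: "real^4 \<Rightarrow> complex^4" where "L v = (1/2) *s cvec v" for v
  define M :: "real^4 \<Rightarrow> complex^4" where "M v = (1/2) *s (\<i> *s cvec v)" for v
  have "linear L" "linear M"
    by (simp_all add: linear_iff L_def M_def cvec_def vec_eq_iff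
        scaleR_conv_of_real[where 'a = complex] algebra_simps)
  then have LM: "bounded_linear L" "bounded_linear M"
    by (simp_all add: linear_conv_bounded_linear)
  have 1: "((\<lambda>w. L (d_x f w) + M (d_y f w)) has_derivative (\<lambda>h. L (X h) + M (Y h))) (at z)"
    unfolding X_def Y_def
    by (intro has_derivative_add bounded_linear.has_derivative[OF LM(1)]
        bounded_linear.has_derivative[OF LM(2)] D(2,3))
  have 2: "L (d_x f w) + M (d_y f w) = delbar (cvec \<circ> f) w" if "w \<in> U" for w
    by (simp add: delbar_def L_def M_def d_x_def d_y_def deriv_cvec[OF U(1) that f] vec_eq_iff
        algebra_simps)
  have "(delbar (cvec \<circ> f) has_derivative (\<lambda>h. L (X h) + M (Y h))) (at z)"
    by (rule has_derivative_transform_within_open[OF 1 U 2])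
  note E = has_derivative_d_x_d_y[OF this]
  have rhs: "cinner (del (cvec \<circ> f) z) (delbar (cvec \<circ> f) z)
      = complex_of_real ((d_x f z \<bullet> d_x f z + d_y f z \<bullet> d_y f z) / 4)"
    by (simp add: del_def delbar_def d_x_def d_y_def deriv_cvec[OF U f] cinner_def cvec_def
        inner_vec_def sum_4 field_simps)
  have "del (delbar (cvec \<circ> f)) z =
      - cinner (del (cvec \<circ> f) z) (delbar (cvec \<circ> f) z) *s cvec (f z)"
    using f U(2) by (simp add: harmonic_on_def)
  then have eq: "del (delbar (cvec \<circ> f)) z $ i =
      - complex_of_real ((d_x f z \<bullet> d_x f z + d_y f z \<bullet> d_y f z) / 4 * f z $ i)" for i
    unfolding rhs by (simp add: cvec_def)
  have lhs: "del (delbar (cvec \<circ> f)) z $ i =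
      Complex ((X 1 + Y \<i>) $ i / 4) ((Y 1 - X \<i>) $ i / 4)" for i
    by (simp add: del_def E L_def M_def cvec_def complex_eq_iff)
  have "(X 1 + Y \<i>) $ i = - (d_x f z \<bullet> d_x f z + d_y f z \<bullet> d_y f z) * f z $ i"
    and "(Y 1 - X \<i>) $ i = 0" for i
    using eq[of i] unfolding lhs by (simp_all add: complex_eq_iff algebra_simps)
  then have "X 1 + Y \<i> = - (d_x f z \<bullet> d_x f z + d_y f z \<bullet> d_y f z) *\<^sub>R f z" "X \<i> = Y 1"
    by (simp_all add: vec_eq_iff)
  then show "d_x (d_x f) z + d_y (d_y f) z
      = - (d_x f z \<bullet> d_x f z + d_y f z \<bullet> d_y f z) *\<^sub>R f z"
    and "d_y (d_x f) z = d_x (d_y f) z"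
    by (simp_all add: has_derivative_d_x_d_y[OF D(2)] has_derivative_d_x_d_y[OF D(3)]
        flip: X_def Y_def)
qed

section \<open>Differentiating the transform\<close>

text \<open>Like \<open>deriv_orthogonal\<close>, but without harmonicity, for use on the transform
  of \<open>f\<close>.\<close>

lemma sphere_derivative_orthogonal:
  fixes g :: "'a::real_normed_vector \<Rightarrow> 'b::real_inner"
  assumes U: "open U" "z \<in> U" and g: "\<And>w. w \<in> U \<Longrightarrow> norm (g w) = 1"
    and D: "(g has_derivative g') (at z)"
  shows "g z \<bullet> g' h = 0"
proof -
  have "((\<lambda>w. g w \<bullet> g w) has_derivative (\<lambda>h. g z \<bullet> g' h + g' h \<bullet> g z)) (at z)"
    by (rule has_derivative_inner[OF D D])
  moreover have "((\<lambda>w. g w \<bullet> g w) has_derivative (\<lambda>h. 0)) (at z)"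
    by (rule has_derivative_transform_within_open[OF has_derivative_const U])
      (use g in \<open>simp add: norm_eq_1\<close>)
  ultimately have "(\<lambda>h. g z \<bullet> g' h + g' h \<bullet> g z) = (\<lambda>h. 0)"
    by (rule has_derivative_unique)
  from fun_cong[OF this, of h] show ?thesis
    by (simp add: inner_commute)
qed

text \<open>The logarithmic derivatives \<open>a, b\<close> of \<open>f\<close> and the rotation \<open>u\<close> with
  \<open>transform s f = f \<odot> u\<close> are all taken as quaternion-valued functions, so that \<open>a = - 2 s - u b\<close>
  can be differentiated.\<close>

lemma transform_transform:
  assumes U: "open U" "z \<in> U" and f: "harmonic_on U f" and ad: "adapted_on U f" and s: "s\<^sup>2 = 1"
  shows "transform (- s) (transform s f) z = f z"
proof -
  \<comment> \<open>On \<open>U\<close> these are \<open>alpha f\<close> and \<open>beta f\<close>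
    without definite descriptions, hence visibly differentiable. In \<open>u\<close> the quaternion
    product replaces the vector product, which it equals by orthogonality; \<open>v\<close> is the
    same vector in \<open>real^3\<close>.\<close>
  define a where "a w = qconj (f w) \<odot> d_x f w" for w
  define b where "b w = qconj (f w) \<odot> d_y f w" for w
  define u where "u w = (2 / (b w \<bullet> b w)) *\<^sub>R (s *\<^sub>R b w + (1/2) *\<^sub>R (a w \<odot> b w))" for w
  define v where "v w = (2 / (beta f w \<bullet> beta f w)) *\<^sub>R
      (s *\<^sub>R beta f w + (1/2) *\<^sub>R cross3 (alpha f w) (beta f w))" for w
  define g where "g = transform s f"

  have on_U: "a w = imq (alpha f w)" "b w = imq (beta f w)" "u w = imq (v w)" "norm (v w) = 1"
      "norm (f w) = 1" "norm (g w) = 1" "g w = f w \<odot> u w" "v w \<bullet> beta f w = 2 * s"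
      "a w = - (2 * s) *\<^sub>R axis 1 1 - u w \<odot> b w" if w: "w \<in> U" for w
  proof -
    note n = norm_at[OF U(1) w f] and x = d_x_eq_alpha[OF U(1) w f] and y = d_y_eq_beta[OF U(1) w f]
    note ab = adapted_alpha_beta[OF U(1) w f ad]
    show "norm (f w) = 1" by (rule n)
    show a: "a w = imq (alpha f w)" and b: "b w = imq (beta f w)"
      by (simp_all add: a_def b_def x y qconj_cancel[OF n])
    show u: "u w = imq (v w)"
      by (simp add: u_def v_def a b imq_mult_imq ab(1) imq_linear)
        (simp add: imq_def inner_vec_def sum_4 sum_3)
    show g: "g w = f w \<odot> u w"
      unfolding g_def u v_def by (rule transform_eqI(3)[OF n x y ab(2)])
    note v = transform_vector[OF ab s, folded v_def]
    show "norm (v w) = 1" "v w \<bullet> beta f w = 2 * s" by (fact v)+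
    then show "norm (g w) = 1"
      unfolding g u by (simp add: norm_qmult_imq[OF n])
    show "a w = - (2 * s) *\<^sub>R axis 1 1 - u w \<odot> b w"
      unfolding a b u by (simp add: imq_mult_imq v imq_linear)
  qed

  have sm: "smooth_on U f" using f by (simp add: harmonic_on_def)
  note D = smooth_on_differentiable[OF sm U(2), THEN differentiable_has_derivative_frechet]
  define F where "F = frechet_derivative f (at z)"
  define X where "X = frechet_derivative (d_x f) (at z)"
  define Y where "Y = frechet_derivative (d_y f) (at z)"
  note D = D[folded F_def X_def Y_def]
  note q = bounded_linear.has_derivative[OF bounded_linear_qconj D(1)]
  define A where "A h = qconj (f z) \<odot> X h + qconj (F h) \<odot> d_x f z" for h
  define B where "B h = qconj (f z) \<odot> Y h + qconj (F h) \<odot> d_y f z" for h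
  have A: "(a has_derivative A) (at z)"
    unfolding a_def[abs_def] A_def[abs_def] by (rule qmult.FDERIV[OF q D(2)])
  have B: "(b has_derivative B) (at z)"
    unfolding b_def[abs_def] B_def[abs_def] by (rule qmult.FDERIV[OF q D(3)])
  have bb: "b z \<bullet> b z \<noteq> 0"
  proof
    assume "b z \<bullet> b z = 0"
    then have "beta f z = 0"
      using on_U(2)[OF U(2)] by (simp add: imq_def vec_eq_iff forall_4 forall_3)
    then show False
      using on_U(8)[OF U(2)] s by simp
  qed
  have "(\<lambda>w. b w \<bullet> b w) differentiable (at z)"
    using differentiableI[OF has_derivative_inner[OF B B]] .
  then have "(\<lambda>w. 2 / (b w \<bullet> b w)) differentiable (at z)"
    using bb by (intro differentiable_divide differentiable_const)
  moreover have "(\<lambda>w. s *\<^sub>R b w + (1/2) *\<^sub>R (a w \<odot> b w)) differentiable (at z)"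
    by (intro differentiable_add differentiable_scaleR differentiable_const
        differentiableI[OF B] differentiableI[OF qmult.FDERIV[OF A B]])
  ultimately have "u differentiable (at z)"
    unfolding u_def[abs_def] by (rule differentiable_scaleR)
  then obtain W where W: "(u has_derivative W) (at z)"
    by (auto simp: differentiable_def)

  have fx: "d_x f z = F 1" "d_y f z = F \<i>" "d_x (d_x f) z = X 1" "d_y (d_x f) z = X \<i>"
      "d_x (d_y f) z = Y 1" "d_y (d_y f) z = Y \<i>"
    by (simp_all add: has_derivative_d_x_d_y[OF D(1)] has_derivative_d_x_d_y[OF D(2)]
        has_derivative_d_x_d_y[OF D(3)])
  note z = on_U[OF U(2)]
  have Fab: "F 1 = f z \<odot> a z" "F \<i> = f z \<odot> b z"
    by (simp_all add: z(1,2) d_x_eq_alpha[OF U f] d_y_eq_beta[OF U f] flip: fx)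
  note h = harmonic_second_derivatives[OF U f, unfolded fx]
  have ff: "f z \<bullet> f z = 1" using z(5) by (simp add: norm_eq_1)

  \<comment> \<open>The real terms from differentiating \<open>qconj f\<close> cancel the right-hand
    side of the harmonic map equation.\<close>
  have harm: "A 1 + B \<i> = 0"
  proof -
    have "A 1 + B \<i> = qconj (f z) \<odot> (X 1 + Y \<i>) + (F 1 \<bullet> F 1 + F \<i> \<bullet> F \<i>) *\<^sub>R axis 1 1"
      by (simp add: A_def B_def fx qmult.add_right qconj_mult_self algebra_simps)
    then show ?thesis
      unfolding h(1) by (simp add: qmult.scaleR_right qconj_mult_self ff flip: scaleR_add_left)
  qed
  \<comment> \<open>The mixed derivatives cancel; what remains comes from \<open>qconj f\<close>,
    and conjugation negates \<open>a\<close> and \<open>b\<close>.\<close>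
  have flat: "A \<i> - B 1 = a z \<odot> b z - b z \<odot> a z"
    unfolding A_def B_def fx h(2) Fab qconj_qmult z(1,2) qconj_imq
    by (simp add: qmult_assoc qconj_cancel[OF z(5)] qmult.minus_left)
  have rel: "A h = - (W h \<odot> b z) - u z \<odot> B h" for h
  proof -
    have "((\<lambda>w. - (2 * s) *\<^sub>R axis 1 1 - u w \<odot> b w) has_derivative
        (\<lambda>h. 0 - (u z \<odot> B h + W h \<odot> b z))) (at z)"
      by (intro has_derivative_diff has_derivative_const qmult.FDERIV W B)
    then have "(a has_derivative (\<lambda>h. 0 - (u z \<odot> B h + W h \<odot> b z))) (at z)"
      by (rule has_derivative_transform_within_open[OF _ U]) (simp add: on_U(9))
    from has_derivative_unique[OF A this] show ?thesis
      by simp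
  qed
  have uu: "u z \<odot> u z = - axis 1 1"
    using z(4) by (simp add: z(3) imq_mult_imq norm_eq_1 imq_linear)
  have ub: "u z \<odot> b z + b z \<odot> u z = - (4 * s) *\<^sub>R axis 1 1"
    using z(8) by (simp add: z(2,3) imq_mult_imq inner_commute cross_skew[of "beta f z"]
        imq_linear vec_eq_iff)
  have inv: "b z \<odot> ((1 / (b z \<bullet> b z)) *\<^sub>R qconj (b z)) = axis 1 1"
    using bb by (simp add: qmult.scaleR_right mult_qconj_self)
  have key: "a z \<odot> u z + W 1 = (2 * s) *\<^sub>R u z + u z \<odot> (b z \<odot> u z + W \<i>)"
    by (rule baecklund_algebra[OF flat harm ub uu inv z(9) rel rel])

  have "((\<lambda>w. f w \<odot> u w) has_derivative (\<lambda>h. f z \<odot> W h + F h \<odot> u z)) (at z)"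
    by (rule qmult.FDERIV[OF D(1) W])
  then have G: "(g has_derivative (\<lambda>h. f z \<odot> W h + F h \<odot> u z)) (at z)"
    by (rule has_derivative_transform_within_open[OF _ U]) (simp add: on_U(7))
  have orth: "g z \<bullet> d_x g z = 0" "g z \<bullet> d_y g z = 0"
    using sphere_derivative_orthogonal[OF U on_U(6) G, of 1]
      sphere_derivative_orthogonal[OF U on_U(6) G, of \<i>]
    by (simp_all add: has_derivative_d_x_d_y[OF G])
  obtain a' b' where x: "d_x g z = g z \<odot> imq a'" and y: "d_y g z = g z \<odot> imq b'"
    using qmult_imq_unique[OF z(6) orth(1)] qmult_imq_unique[OF z(6) orth(2)] by blast
  have uux: "u z \<odot> (u z \<odot> w) = - w" for w
    by (simp add: uu qmult_algebra flip: qmult_assoc)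
  \<comment> \<open>Comparing this with the product rule for \<open>g = f u\<close> turns
    \<open>key\<close> into \<open>u a' = 2 s u + u (u b')\<close>. A further left multiplication by
    \<open>u\<close> removes the common factor.\<close>
  have "u z \<odot> imq a' = qconj (f z) \<odot> d_x g z" "u z \<odot> imq b' = qconj (f z) \<odot> d_y g z"
    by (simp_all add: x y z(7) qmult_assoc qconj_cancel[OF z(5)])
  then have a'b': "u z \<odot> imq a' = a z \<odot> u z + W 1" "u z \<odot> imq b' = b z \<odot> u z + W \<i>"
    by (simp_all add: has_derivative_d_x_d_y[OF G] Fab qmult.add_right qmult_assoc
        qconj_cancel[OF z(5)])
  then have "u z \<odot> imq a' = (2 * s) *\<^sub>R u z + u z \<odot> (u z \<odot> imq b')"
    by (simp only: key)
  then have "u z \<odot> (u z \<odot> imq a') = u z \<odot> ((2 * s) *\<^sub>R u z + u z \<odot> (u z \<odot> imq b'))"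
    by simp
  then have "- imq a' = - ((2 * s) *\<^sub>R axis 1 1 + u z \<odot> imq b')"
    by (simp only: uux uu qmult.add_right qmult.scaleR_right scaleR_minus_right minus_add_distrib)
      (simp add: qmult.minus_right)
  then have "imq a' = (2 * s) *\<^sub>R axis 1 1 + imq (v z) \<odot> imq b'"
    by (simp only: neg_equal_iff_equal z(3))
  then show ?thesis
    using transform_inverse_at[OF z(6) x y z(4) s] z(3,7) by (simp add: g_def)
qed

theorem theorem3p5:
  fixes U :: "complex set" and f :: "complex \<Rightarrow> real^4"
  assumes "open U"
    and "harmonic_on U f"
    and "nonconformal_on U f"
    and "adapted_on U f"
    and "\<forall>z\<in>U. alpha f z \<noteq> 0"
  shows "\<forall>z\<in>U. minus_transform (plus_transform f) z = f z \<and>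
               plus_transform (minus_transform f) z = f z"
  using transform_transform[OF assms(1) _ assms(2,4), of _ 1]
    transform_transform[OF assms(1) _ assms(2,4), of _ "- 1"]
  by (simp add: plus_transform_def minus_transform_def)

end
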